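(* Let $\emptyset\neq L\subseteq M\subset N\subseteq V$ and let $S\subseteq M$ with $1\le |S|\le |M|$. The table $\mathfrak{X}_{N}$ is collapsible over $N\setminus M$ into the table $\mathfrak{X}_{M}$ with respect to the set $C_{S}=\{\lambda_{A}^{N}\mid S\subseteq A\subseteq L\}$ of MLL parameters (that is, with respect to every element of $C_S$) if and only if $$\sum_{R\subseteq S}(-1)^{|S\setminus R|}\,\tilde d_{L_{R}}^{(M)}(x_{L_{R}})=0\qquad\text{for all }x_L\in\mathfrak{X}_L,$$ where $L_{R}=L\setminus R$ and $x_{L_R}$ is the restriction of $x_L$ to $L_R$.
   Context: $V$ is a finite index set; for $v\in V$, $X_v$ is a categorical variable with finite level set $\mathfrak{X}_v=\{0,1,\dots,|\mathfrak{X}_v|-1\}$. For $A\subseteq V$, $\mathfrak{X}_A=\prod_{v\in A}\mathfrak{X}_v$ (with $|\mathfrak{X}_\emptyset|=1$); for $x\in\mathfrak{X}_A$ and $B\subseteq A$, $x_B$ is the restriction of $x$ to $B$. The joint distribution $p=p_V$ of $(X_v)_{v\in V}$ on $\mathfrak{X}_V$ is strictly positive, and $p_A$ denotes its marginal on $\mathfrak{X}_A$. The symbol $\subset$ denotes strict inclusion. For $L\subseteq M\subseteq V$ and $x_L\in\mathfrak{X}_L$, define $$\nu_L^M(x_L)=\frac{1}{|\mathfrak{X}_{M\setminus L}|}\sum_{j_M\in\mathfrak{X}_M:\,j_L=x_L}\log p_M(j_M),\qquad \lambda_L^M(x_L)=\sum_{L'\subseteq L}(-1)^{|L\setminus L'|}\nu_{L'}^M(x_{L'}).$$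 $\lambda_L^M$ is called a marginal log-linear (MLL) parameter. For $\emptyset\ne A\subseteq M\subset N\subseteq V$, the table $\mathfrak{X}_N$ is collapsible over $N\setminus M$ into $\mathfrak{X}_M$ with respect to $\lambda_A^N$ if $\lambda_A^M(x_A)=\lambda_A^N(x_A)$ for all $x_A\in\mathfrak{X}_A$. For $M\subset N$ define $d^{(M)}(x_M)=\log p_M(x_M)-\nu_M^N(x_M)$ for $x_M\in\mathfrak{X}_M$, and for $Z\subseteq M$, $$\tilde d_Z^{(M)}(x_Z)=\frac{1}{|\mathfrak{X}_{M\setminus Z}|}\sum_{j_M\in\mathfrak{X}_M:\,j_Z=x_Z}d^{(M)}(j_M).$$ *)

theory Defs
  imports "HOL-Probability.Probability_Mass_Function"
begin

text \<open>
  The variable \<open>v\<close> has level set \<open>{0, ..., k v - 1}\<close>. A cell of the table indexed by \<open>A\<close>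
  is an extensional function on \<open>A\<close>, so the restriction of \<open>x\<close> to \<open>B\<close> is \<open>restrict x B\<close>
  and the table indexed by the empty set has exactly one cell.
\<close>

definition table :: "('v \<Rightarrow> nat) \<Rightarrow> 'v set \<Rightarrow> ('v \<Rightarrow> nat) set" where
  "table k A = (\<Pi>\<^sub>E v\<in>A. {..<k v})"

definition marginal :: "('v \<Rightarrow> nat) pmf \<Rightarrow> 'v set \<Rightarrow> ('v \<Rightarrow> nat) pmf" where
  "marginal p A = map_pmf (\<lambda>x. restrict x A) p"

text \<open>In \<open>nu k p M L\<close> and \<open>mll k p M L\<close> the margin \<open>M\<close> (the superscript) comes before the
  subscript \<open>L\<close>.\<close>

definition nu :: "('v \<Rightarrow> nat) \<Rightarrow> ('v \<Rightarrow> nat) pmf \<Rightarrow> 'v set \<Rightarrow> 'v set \<Rightarrow> ('v \<Rightarrow> nat) \<Rightarrow> real" where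
  "nu k p M L x =
    1 / real (card (table k (M - L))) *
      (\<Sum>j\<in>{j \<in> table k M. restrict j L = x}. ln (pmf (marginal p M) j))"

definition mll :: "('v \<Rightarrow> nat) \<Rightarrow> ('v \<Rightarrow> nat) pmf \<Rightarrow> 'v set \<Rightarrow> 'v set \<Rightarrow> ('v \<Rightarrow> nat) \<Rightarrow> real" where
  "mll k p M L x =
    (\<Sum>L'\<in>Pow L. (-1) ^ card (L - L') * nu k p M L' (restrict x L'))"

text \<open>The table indexed by \<open>N\<close> is collapsible over \<open>N - M\<close> into the table indexed by \<open>M\<close> with
  respect to the parameter \<open>mll k p N A\<close>. Only meaningful for nonempty \<open>A \<subseteq> M\<close> and \<open>M \<subset> N\<close>.\<close>

definition collapsible ::
  "('v \<Rightarrow> nat) \<Rightarrow> ('v \<Rightarrow> nat) pmf \<Rightarrow> 'v set \<Rightarrow> 'v set \<Rightarrow> 'v set \<Rightarrow> bool" where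
  "collapsible k p N M A \<longleftrightarrow> (\<forall>x\<in>table k A. mll k p M A x = mll k p N A x)"

definition discrepancy ::
  "('v \<Rightarrow> nat) \<Rightarrow> ('v \<Rightarrow> nat) pmf \<Rightarrow> 'v set \<Rightarrow> 'v set \<Rightarrow> ('v \<Rightarrow> nat) \<Rightarrow> real" where
  "discrepancy k p N M x = ln (pmf (marginal p M) x) - nu k p N M x"

definition mean_discrepancy ::
  "('v \<Rightarrow> nat) \<Rightarrow> ('v \<Rightarrow> nat) pmf \<Rightarrow> 'v set \<Rightarrow> 'v set \<Rightarrow> 'v set \<Rightarrow> ('v \<Rightarrow> nat) \<Rightarrow> real" where
  "mean_discrepancy k p N M Z x =
    1 / real (card (table k (M - Z))) *
      (\<Sum>j\<in>{j \<in> table k M. restrict j Z = x}. discrepancy k p N M j)"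

end

theory Submission
  imports Defs
begin

text \<open>
  Averaging out a set \<open>W\<close> of coordinates is an operator \<open>E\<^sub>W\<close> on real functions of a cell, and
  \<open>E\<^sub>U E\<^sub>W = E\<^bsub>U \<union> W\<^esub>\<close> for disjoint \<open>U\<close> and \<open>W\<close> (\<open>average_average\<close>). Both \<open>nu\<close> and
  \<open>mean_discrepancy\<close> are such averages, so averaging the discrepancy down to \<open>Z\<close> yields the
  difference of the two functions \<open>nu\<close> on \<open>Z\<close>. Hence the difference of the MLL parameters of
  \<open>A\<close> in the margins \<open>M\<close> and \<open>N\<close> is the full alternating sum
  \<open>\<mu>\<^sub>A = (\<Sum>B\<subseteq>A. (-1)\<^bsup>|A - B|\<^esup> h B)\<close> of the mean discrepancies \<open>h B\<close>, while the criterion concerns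
  the partial alternating sums \<open>T\<^sub>A = (\<Sum>R\<subseteq>S. (-1)\<^bsup>|S - R|\<^esup> h (A - R))\<close>, at \<open>A = L\<close> only.

  Suppose \<open>S \<subseteq> L\<close>. Two facts connect \<open>\<mu>\<close> and \<open>T\<close>. First, splitting off the part of a subset that
  lies in \<open>S\<close> writes \<open>\<mu>\<^sub>A\<close> as a signed sum of the \<open>T\<^sub>B\<close> with \<open>S \<subseteq> B \<subseteq> A\<close>, in which \<open>T\<^sub>A\<close> has
  coefficient \<open>\<plusminus>1\<close>. This system is triangular, so all \<open>\<mu>\<^sub>A\<close> with \<open>S \<subseteq> A \<subseteq> L\<close> vanish at a cell
  exactly if all \<open>T\<^sub>A\<close> do (\<open>alternating_sums_vanish_iff\<close>). Secondly, averaging \<open>T\<^sub>L\<close> over \<open>L - A\<close>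
  gives \<open>T\<^sub>A\<close>, so that \<open>T\<^sub>L = 0\<close> on the whole table already forces \<open>T\<^sub>A = 0\<close> for every such \<open>A\<close>.

  If \<open>S\<close> is not contained in \<open>L\<close>, there is no parameter to consider, and the criterion holds
  because toggling an element of \<open>S - L\<close> in \<open>R\<close> changes the sign but not \<open>L - R\<close>.
\<close>

section \<open>Averaging over coordinates\<close>

text \<open>The coordinates in \<open>W\<close> are overridden in place and the index set of the cell does not
  change, so that all these operators act on the same functions and can be composed.\<close>

definition average ::
  "('v \<Rightarrow> nat) \<Rightarrow> 'v set \<Rightarrow> (('v \<Rightarrow> nat) \<Rightarrow> real) \<Rightarrow> ('v \<Rightarrow> nat) \<Rightarrow> real" where
  "average k W f x = (\<Sum>w\<in>table k W. f (override_on x w W)) / real (card (table k W))"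

lemma restrict_in_table: "x \<in> table k A \<Longrightarrow> B \<subseteq> A \<Longrightarrow> restrict x B \<in> table k B"
  unfolding table_def by (auto simp: PiE_iff)

lemma average_cong:
  assumes "\<And>w. w \<in> table k W \<Longrightarrow> f (override_on x w W) = g (override_on x w W)"
  shows "average k W f x = average k W g x"
  unfolding average_def using assms by (simp cong: sum.cong)

lemma average_diff:
  "average k W (\<lambda>y. f y - g y) x = average k W f x - average k W g x"
  by (simp add: average_def sum_subtractf diff_divide_distrib)

lemma average_linear_combination:
  "average k W (\<lambda>y. \<Sum>i\<in>I. c i * g i y) x = (\<Sum>i\<in>I. c i * average k W (g i) x)"
proof -
  have "(\<Sum>w\<in>table k W. \<Sum>i\<in>I. c i * g i (override_on x w W)) =
      (\<Sum>i\<in>I. c i * (\<Sum>w\<in>table k W. g i (override_on x w W)))"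
    by (subst sum.swap) (simp add: sum_distrib_left)
  then show ?thesis
    by (simp only: average_def sum_divide_distrib[of _ I] times_divide_eq_right)
qed

lemma average_average:
  assumes "finite U" "finite W" "U \<inter> W = {}"
  shows "average k U (average k W f) x = average k (U \<union> W) f x"
proof -
  have "(\<Sum>u\<in>table k U. \<Sum>w\<in>table k W. f (override_on (override_on x u U) w W)) =
      (\<Sum>(u, w)\<in>table k U \<times> table k W. f (override_on (override_on x u U) w W))"
    by (simp add: sum.cartesian_product)
  also have "\<dots> = (\<Sum>t\<in>table k (U \<union> W). f (override_on x t (U \<union> W)))"
  proof (rule sum.reindex_bij_witness[where
        i = "\<lambda>t. (restrict t U, restrict t W)" and
        j = "\<lambda>(u, w). restrict (override_on u w W) (U \<union> W)"], goal_cases)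
    case (1 a)
    then show ?case
      using assms by (auto simp: table_def PiE_iff extensional_def override_on_def fun_eq_iff)
  next
    case (2 a)
    then show ?case
      by (auto simp: table_def PiE_iff override_on_def)
  next
    case (3 b)
    then show ?case
      by (auto simp: table_def PiE_iff extensional_def override_on_def fun_eq_iff)
  next
    case (4 b)
    then show ?case
      by (auto simp: table_def PiE_iff)
  next
    case (5 a)
    then show ?case
      by (auto simp: override_on_def intro!: arg_cong[where f = f])
  qed
  finally have "(\<Sum>u\<in>table k U. \<Sum>w\<in>table k W. f (override_on (override_on x u U) w W)) =
      (\<Sum>t\<in>table k (U \<union> W). f (override_on x t (U \<union> W)))" .
  moreover have "card (table k (U \<union> W)) = card (table k U) * card (table k W)"
    using assms by (simp add: table_def card_PiE prod.union_disjoint)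
  ultimately show ?thesis
    by (simp add: average_def flip: sum_divide_distrib)
qed

text \<open>The fibre of the restriction map over a cell of the smaller table is a copy of the table of
  the remaining coordinates; this turns the sums that define \<open>nu\<close> and \<open>mean_discrepancy\<close> into
  averages.\<close>

lemma fibre_mean_eq_average:
  assumes "Z \<subseteq> M" "restrict x Z \<in> table k Z"
  shows "1 / real (card (table k (M - Z))) *
      (\<Sum>j\<in>{j \<in> table k M. restrict j Z = restrict x Z}. f j) =
    average k (M - Z) (\<lambda>y. f (restrict y M)) x"
proof -
  have "(\<Sum>j\<in>{j \<in> table k M. restrict j Z = restrict x Z}. f j) =
      (\<Sum>w\<in>table k (M - Z). f (restrict (override_on x w (M - Z)) M))"
  proof (rule sum.reindex_bij_witness[where
        j = "\<lambda>j. restrict j (M - Z)" and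
        i = "\<lambda>w. restrict (override_on x w (M - Z)) M"], goal_cases)
    case (1 a)
    then have "a v = x v" if "v \<in> Z" for v
      using that by (auto dest: fun_cong[where x = v])
    with 1 show ?case
      by (auto simp: table_def PiE_iff extensional_def override_on_def fun_eq_iff)
  next
    case (2 a)
    then show ?case
      by (auto simp: table_def PiE_iff)
  next
    case (3 b)
    then show ?case
      by (auto simp: table_def PiE_iff extensional_def override_on_def fun_eq_iff)
  next
    case (4 b)
    then show ?case
      using assms by (auto simp: table_def PiE_iff extensional_def override_on_def fun_eq_iff)
  next
    case (5 a)
    then have "a v = x v" if "v \<in> Z" for v
      using that by (auto dest: fun_cong[where x = v])
    with 5 have "restrict (override_on x (restrict a (M - Z)) (M - Z)) M = a"
      by (auto simp: table_def PiE_iff extensional_def override_on_def fun_eq_iff)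
    then show ?case
      by simp
  qed
  then show ?thesis
    by (simp add: average_def)
qed

section \<open>Mean discrepancies\<close>

lemma nu_eq_average:
  assumes "L \<subseteq> M" "restrict x L \<in> table k L"
  shows "nu k p M L (restrict x L) =
    average k (M - L) (\<lambda>y. ln (pmf (marginal p M) (restrict y M))) x"
  unfolding nu_def using assms by (rule fibre_mean_eq_average)

lemma mean_discrepancy_eq_average:
  assumes "Z \<subseteq> M" "restrict x Z \<in> table k Z"
  shows "mean_discrepancy k p N M Z (restrict x Z) =
    average k (M - Z) (\<lambda>y. discrepancy k p N M (restrict y M)) x"
  unfolding mean_discrepancy_def using assms by (rule fibre_mean_eq_average)

lemma restrict_override_in_table:
  assumes "restrict x (A - W) \<in> table k (A - W)" "w \<in> table k W" "W \<subseteq> A"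
  shows "restrict (override_on x w W) A \<in> table k A"
  using assms by (auto simp: table_def PiE_iff override_on_def)

text \<open>The \<open>nu\<close>-part of the discrepancy is an average over \<open>N - M\<close>, so a further average over
  \<open>M - Z\<close> turns it into \<open>nu k p N Z\<close>.\<close>

lemma mean_discrepancy_eq_nu_diff:
  assumes "finite N" "Z \<subseteq> M" "M \<subseteq> N" "restrict x Z \<in> table k Z"
  shows "mean_discrepancy k p N M Z (restrict x Z) =
    nu k p M Z (restrict x Z) - nu k p N Z (restrict x Z)"
proof -
  let ?q = "\<lambda>K y. ln (pmf (marginal p K) (restrict y K))"
  have Z: "M - (M - Z) = Z"
    using assms by blast
  have "mean_discrepancy k p N M Z (restrict x Z) =
      average k (M - Z) (\<lambda>y. discrepancy k p N M (restrict y M)) x"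
    using assms by (intro mean_discrepancy_eq_average)
  also have "\<dots> = average k (M - Z) (\<lambda>y. ?q M y - average k (N - M) (?q N) y) x"
  proof (rule average_cong)
    fix w assume "w \<in> table k (M - Z)"
    then have "restrict (override_on x w (M - Z)) M \<in> table k M"
      using assms by (intro restrict_override_in_table) (auto simp: Z)
    then show "discrepancy k p N M (restrict (override_on x w (M - Z)) M) =
        ?q M (override_on x w (M - Z)) - average k (N - M) (?q N) (override_on x w (M - Z))"
      using assms by (simp add: discrepancy_def nu_eq_average)
  qed
  also have "\<dots> = average k (M - Z) (?q M) x - average k (M - Z) (average k (N - M) (?q N)) x"
    by (rule average_diff)
  also have "average k (M - Z) (average k (N - M) (?q N)) x = average k (N - Z) (?q N) x"
  proof -
    have "(M - Z) \<union> (N - M) = N - Z"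
      using assms by blast
    then show ?thesis
      using assms by (subst average_average) (auto intro: finite_subset)
  qed
  finally show ?thesis
    using assms by (simp only: nu_eq_average subset_trans[OF assms(2,3)])
qed

lemma mll_diff_eq_alternating_sum:
  assumes "finite N" "A \<subseteq> M" "M \<subseteq> N" "x \<in> table k A"
  shows "mll k p M A x - mll k p N A x =
    (\<Sum>B\<in>Pow A. (-1) ^ card (A - B) * mean_discrepancy k p N M B (restrict x B))"
proof -
  have "mean_discrepancy k p N M B (restrict x B) =
      nu k p M B (restrict x B) - nu k p N B (restrict x B)" if "B \<in> Pow A" for B
    using assms that by (intro mean_discrepancy_eq_nu_diff restrict_in_table) auto
  then show ?thesis
    by (simp add: mll_def right_diff_distrib flip: sum_subtractf)
qed

lemma average_mean_discrepancy:
  assumes "finite M" "U \<subseteq> Z" "Z \<subseteq> M" "restrict x (Z - U) \<in> table k (Z - U)"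
  shows "average k U (\<lambda>y. mean_discrepancy k p N M Z (restrict y Z)) x =
    mean_discrepancy k p N M (Z - U) (restrict x (Z - U))"
proof -
  let ?d = "\<lambda>y. discrepancy k p N M (restrict y M)"
  have "average k U (\<lambda>y. mean_discrepancy k p N M Z (restrict y Z)) x =
      average k U (average k (M - Z) ?d) x"
    using assms
    by (intro average_cong mean_discrepancy_eq_average restrict_override_in_table)
  also have "\<dots> = average k (M - (Z - U)) ?d x"
  proof -
    have "U \<union> (M - Z) = M - (Z - U)"
      using assms by blast
    then show ?thesis
      using assms by (subst average_average) (auto intro: finite_subset)
  qed
  also have "\<dots> = mean_discrepancy k p N M (Z - U) (restrict x (Z - U))"
    using assms by (intro mean_discrepancy_eq_average[symmetric]) auto
  finally show ?thesis .
qed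

text \<open>Since \<open>R \<subseteq> S \<subseteq> A\<close>, averaging over \<open>L - A\<close> takes the index set \<open>L - R\<close> to \<open>A - R\<close>; so the
  partial alternating sum for \<open>L\<close> determines those for all \<open>A\<close> between \<open>S\<close> and \<open>L\<close>.\<close>

lemma average_partial_alternating_sum:
  assumes "finite M" "S \<subseteq> A" "A \<subseteq> L" "L \<subseteq> M" "x \<in> table k A"
  shows "average k (L - A)
      (\<lambda>y. \<Sum>R\<in>Pow S. (-1) ^ card (S - R) *
        mean_discrepancy k p N M (L - R) (restrict y (L - R))) x =
    (\<Sum>R\<in>Pow S. (-1) ^ card (S - R) *
        mean_discrepancy k p N M (A - R) (restrict x (A - R)))"
  unfolding average_linear_combination
proof (intro sum.cong refl arg_cong2[where f = "(*)"])
  fix R assume "R \<in> Pow S"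
  then have "L - R - (L - A) = A - R" and "L - A \<subseteq> L - R" and "L - R \<subseteq> M"
    using assms by auto
  moreover have "restrict x (A - R) \<in> table k (A - R)"
    using assms(5) by (rule restrict_in_table) auto
  ultimately show "average k (L - A)
      (\<lambda>y. mean_discrepancy k p N M (L - R) (restrict y (L - R))) x =
    mean_discrepancy k p N M (A - R) (restrict x (A - R))"
    using assms(1) average_mean_discrepancy[of M "L - A" "L - R" x k p N] by (simp only:)
qed

section \<open>Alternating sums over subsets\<close>

text \<open>A subset of \<open>A\<close> is \<open>A - W - R\<close> for unique \<open>W \<subseteq> A - S\<close> and \<open>R \<subseteq> S\<close>, and its complement
  in \<open>A\<close> has \<open>|W| + |R|\<close> elements.\<close>

lemma alternating_sum_split:
  fixes h :: "'a set \<Rightarrow> real"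
  assumes "finite A" "S \<subseteq> A"
  shows "(\<Sum>B\<in>Pow A. (-1) ^ card (A - B) * h B) =
    (-1) ^ card S * (\<Sum>W\<in>Pow (A - S). (-1) ^ card W *
      (\<Sum>R\<in>Pow S. (-1) ^ card (S - R) * h (A - W - R)))"
proof -
  have fS: "finite S"
    using assms by (rule finite_subset[rotated])
  have "(\<Sum>B\<in>Pow A. (-1) ^ card (A - B) * h B) =
      (\<Sum>(W, R)\<in>Pow (A - S) \<times> Pow S. (-1) ^ card W * ((-1) ^ card R * h (A - W - R)))"
  proof (rule sum.reindex_bij_witness[where
        i = "\<lambda>(W, R). A - W - R" and
        j = "\<lambda>B. (A - S - B, S - B)"], goal_cases)
    case (5 B)
    have "A - B = (A - S - B) \<union> (S - B)" and "A - (A - S - B) - (S - B) = B"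
      using assms 5 by auto
    moreover have "card ((A - S - B) \<union> (S - B)) = card (A - S - B) + card (S - B)"
      using assms fS by (intro card_Un_disjoint) auto
    ultimately show ?case
      by (simp add: power_add)
  qed (use assms in auto)
  also have "\<dots> = (\<Sum>W\<in>Pow (A - S). (-1) ^ card W *
      (\<Sum>R\<in>Pow S. (-1) ^ card R * h (A - W - R)))"
    by (simp add: sum.cartesian_product[symmetric] sum_distrib_left)
  also have "\<dots> = (-1) ^ card S * (\<Sum>W\<in>Pow (A - S). (-1) ^ card W *
      (\<Sum>R\<in>Pow S. (-1) ^ card (S - R) * h (A - W - R)))"
  proof -
    have sgn: "(-1) ^ card R = (-1) ^ card S * ((-1) ^ card (S - R) :: real)"
      if "R \<in> Pow S" for R
    proof -
      have "card S = card (S - R) + card R"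
        using that fS by (metis Pow_iff card_Diff_subset card_mono finite_subset le_add_diff_inverse2)
      then show ?thesis
        by (simp add: power_add)
    qed
    have "(\<Sum>R\<in>Pow S. (-1) ^ card R * h (A - W - R)) =
        (-1) ^ card S * (\<Sum>R\<in>Pow S. (-1) ^ card (S - R) * h (A - W - R))" for W
      unfolding sum_distrib_left by (intro sum.cong refl) (subst sgn, assumption, rule mult.assoc)
    then show ?thesis
      by (simp add: sum_distrib_left mult.left_commute)
  qed
  finally show ?thesis .
qed

text \<open>In \<open>alternating_sum_split\<close> the summand for \<open>W = {}\<close> is the partial sum for \<open>A\<close> itself and
  the others belong to proper subsets of \<open>A\<close>; this is the triangular system, solved here by
  induction on \<open>A\<close>.\<close>

lemma alternating_sums_vanish_iff:
  fixes h :: "'a set \<Rightarrow> real"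
  assumes "finite L"
  shows "(\<forall>A. S \<subseteq> A \<and> A \<subseteq> L \<longrightarrow> (\<Sum>B\<in>Pow A. (-1) ^ card (A - B) * h B) = 0) \<longleftrightarrow>
    (\<forall>A. S \<subseteq> A \<and> A \<subseteq> L \<longrightarrow> (\<Sum>R\<in>Pow S. (-1) ^ card (S - R) * h (A - R)) = 0)"
    (is "(\<forall>A. _ \<longrightarrow> ?m A = 0) \<longleftrightarrow> (\<forall>A. _ \<longrightarrow> ?T A = 0)")
proof (intro iffI allI impI)
  fix A assume T: "\<forall>A. S \<subseteq> A \<and> A \<subseteq> L \<longrightarrow> ?T A = 0" and A: "S \<subseteq> A \<and> A \<subseteq> L"
  then have "finite A"
    using assms finite_subset by blast
  moreover have "?T (A - W) = 0" if "W \<in> Pow (A - S)" for W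
    using T A that by blast
  ultimately show "?m A = 0"
    using A by (subst alternating_sum_split[of A S]) simp_all
next
  fix A assume m: "\<forall>A. S \<subseteq> A \<and> A \<subseteq> L \<longrightarrow> ?m A = 0" and A: "S \<subseteq> A \<and> A \<subseteq> L"
  have "finite A"
    using A assms finite_subset by blast
  then show "?T A = 0"
    using A
  proof (induction A rule: finite_psubset_induct)
    case (psubset A)
    have "?T (A - W) = 0" if "W \<in> Pow (A - S) - {{}}" for W
      using psubset.prems that by (intro psubset.IH) auto
    then have "(\<Sum>W\<in>Pow (A - S). (-1) ^ card W * ?T (A - W)) = ?T A"
      using psubset.hyps by (subst sum.remove[of _ "{}"]) simp_all
    moreover have "?m A = 0"
      using m psubset.prems by blast
    ultimately show ?case
      using alternating_sum_split[of A S h] psubset by simp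
  qed
qed

text \<open>Toggling \<open>s\<close> is a sign-reversing involution on the subsets of \<open>S\<close>.\<close>

lemma alternating_sum_eq_0_if_toggle_invariant:
  fixes h :: "'a set \<Rightarrow> real"
  assumes "finite S" "s \<in> S" "\<And>R. h (insert s R) = h (R - {s})"
  shows "(\<Sum>R\<in>Pow S. (-1) ^ card (S - R) * h R) = 0"
proof -
  let ?t = "\<lambda>R. if s \<in> R then R - {s} else insert s R"
  have h: "h (?t R) = h R" for R
  proof (cases "s \<in> R")
    case True
    then have "h (R - {s}) = h R"
      using assms(3)[of R, symmetric] by (simp only: insert_absorb)
    then show ?thesis
      using True by (simp only: if_True)
  next
    case False
    then have "h (insert s R) = h R"
      using assms(3)[of R] by simp
    then show ?thesis
      using False by (simp only: if_False)
  qed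
  have sgn: "(-1) ^ card (S - ?t R) = - ((-1) ^ card (S - R) :: real)" if "R \<in> Pow S" for R
  proof (cases "s \<in> R")
    case True
    then have "S - ?t R = insert s (S - R)"
      using assms that by auto
    then show ?thesis
      using True assms by simp
  next
    case False
    then have "S - R = insert s (S - insert s R)"
      using assms that by auto
    then have "card (S - R) = Suc (card (S - insert s R))"
      using assms(1) by (metis DiffD2 card_insert_disjoint finite_Diff insertI1)
    then show ?thesis
      using False by simp
  qed
  have "(\<Sum>R\<in>Pow S. (-1) ^ card (S - R) * h R) =
      (\<Sum>R\<in>Pow S. - ((-1) ^ card (S - R) * h R))"
  proof (rule sum.reindex_bij_witness[where i = ?t and j = ?t], goal_cases)
    case (5 R)
    then show ?case
      by (simp only: h sgn)
  qed (use assms in \<open>auto split: if_splits\<close>)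
  then show ?thesis
    by (simp add: sum_negf)
qed

section \<open>Characterisation of collapsibility\<close>

theorem theorem3p2:
  fixes V L M N S :: "'v set" and k :: "'v \<Rightarrow> nat" and p :: "('v \<Rightarrow> nat) pmf"
  assumes "finite V"
    and "set_pmf p = table k V"
    and "L \<noteq> {}" and "L \<subseteq> M" and "M \<subset> N" and "N \<subseteq> V"
    and "S \<subseteq> M" and "1 \<le> card S" and "card S \<le> card M"
  shows "(\<forall>A. S \<subseteq> A \<and> A \<subseteq> L \<longrightarrow> collapsible k p N M A) \<longleftrightarrow>
    (\<forall>x\<in>table k L.
      (\<Sum>R\<in>Pow S. (-1) ^ card (S - R) * mean_discrepancy k p N M (L - R) (restrict x (L - R))) = 0)"
proof (cases "S \<subseteq> L")
  case False
  then obtain s where s: "s \<in> S" "s \<notin> L"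
    by blast
  have "finite S"
    using assms(8) by (simp add: card_ge_0_finite)
  have "L - insert s R = L - (R - {s})" for R
    using s by auto
  with \<open>finite S\<close> have "(\<Sum>R\<in>Pow S. (-1) ^ card (S - R) *
      mean_discrepancy k p N M (L - R) (restrict x (L - R))) = 0" for x
    using s(1) by (intro alternating_sum_eq_0_if_toggle_invariant[where s = s]) (simp_all only:)
  then show ?thesis
    using False by blast
next
  case True
  have fin: "finite N" "finite M" "finite L"
    using assms(1,4-6) by (meson finite_subset psubset_imp_subset)+
  (* m is the difference of the MLL parameters in the two margins. The restrictions inside h make
     m A and T A meaningful on cells of any table that includes A. *)
  define h where "h = (\<lambda>x B. mean_discrepancy k p N M B (restrict x B))"
  define m where "m = (\<lambda>A x. \<Sum>B\<in>Pow A. (-1) ^ card (A - B) * h x B)"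
  define T where "T = (\<lambda>A x. \<Sum>R\<in>Pow S. (-1) ^ card (S - R) * h x (A - R))"
  have h_restrict: "h (restrict x A) B = h x B" if "B \<subseteq> A" for x A B
    using that by (simp add: h_def Int_absorb1)
  have m_restrict: "m B (restrict x A) = m B x" if "B \<subseteq> A" for x A B
    unfolding m_def using that by (intro sum.cong refl) (simp add: h_restrict subset_trans)
  have T_restrict: "T B (restrict x A) = T B x" if "B \<subseteq> A" for x A B
    unfolding T_def using that by (intro sum.cong refl) (subst h_restrict, auto)
  have vanish_iff: "(\<forall>A. S \<subseteq> A \<and> A \<subseteq> K \<longrightarrow> m A x = 0) \<longleftrightarrow> (\<forall>A. S \<subseteq> A \<and> A \<subseteq> K \<longrightarrow> T A x = 0)"
    if "K \<subseteq> L" for K x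
    unfolding m_def T_def
    using finite_subset[OF that fin(3)] by (rule alternating_sums_vanish_iff)
  have collapsible_iff: "collapsible k p N M A \<longleftrightarrow> (\<forall>x\<in>table k A. m A x = 0)" if "A \<subseteq> L" for A
  proof -
    have "mll k p M A x - mll k p N A x = m A x" if "x \<in> table k A" for x
      unfolding m_def h_def using that \<open>A \<subseteq> L\<close> assms fin
      by (intro mll_diff_eq_alternating_sum) auto
    then show ?thesis
      by (fastforce simp: collapsible_def)
  qed
  have T_average: "average k (L - A) (T L) x = T A x"
    if "S \<subseteq> A" "A \<subseteq> L" "x \<in> table k A" for A x
    unfolding T_def h_def using that assms fin
    by (intro average_partial_alternating_sum) auto
  have "(\<forall>A. S \<subseteq> A \<and> A \<subseteq> L \<longrightarrow> collapsible k p N M A) \<longleftrightarrow> (\<forall>x\<in>table k L. T L x = 0)"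
  proof (intro iffI ballI allI impI)
    fix x assume C: "\<forall>A. S \<subseteq> A \<and> A \<subseteq> L \<longrightarrow> collapsible k p N M A" and x: "x \<in> table k L"
    have "m A x = 0" if "S \<subseteq> A \<and> A \<subseteq> L" for A
    proof -
      have "m A (restrict x A) = 0"
        using C collapsible_iff[of A] restrict_in_table[OF x, of A] that by simp
      then show ?thesis
        by (simp add: m_restrict)
    qed
    then show "T L x = 0"
      using vanish_iff[of L x] True by blast
  next
    fix A assume T: "\<forall>x\<in>table k L. T L x = 0" and A: "S \<subseteq> A \<and> A \<subseteq> L"
    have T0: "T B y = 0" if "S \<subseteq> B" "B \<subseteq> L" "y \<in> table k B" for B y
    proof -
      have "T L (override_on y w (L - B)) = 0" if w: "w \<in> table k (L - B)" for w
      proof -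
        have "override_on y w (L - B) \<in> table k L"
          using w \<open>B \<subseteq> L\<close> \<open>y \<in> table k B\<close>
          by (auto simp: table_def PiE_iff override_on_def extensional_def)
        then show ?thesis
          using T by blast
      qed
      then have "average k (L - B) (T L) y = 0"
        by (simp add: average_def)
      then show ?thesis
        using T_average that by simp
    qed
    have "m A x = 0" if x: "x \<in> table k A" for x
    proof -
      have "T B x = 0" if "S \<subseteq> B \<and> B \<subseteq> A" for B
        using T0[of B "restrict x B"] restrict_in_table[OF x, of B] that A T_restrict[of B B x]
        by (simp only: subset_refl subset_trans[of B A L])
      then show ?thesis
        using vanish_iff[of A x] A by blast
    qed
    then show "collapsible k p N M A"
      using A collapsible_iff[of A] by simp
  qed
  then show ?thesis
    by (simp add: T_def h_def)
qed

end
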